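(* Let $D\subset\mathbb{Z}^2$ and let $q:D\to\mathbb{R}^3$ be a discrete affine minimal map with discrete affine metric $F$ and discrete cubic form coefficients $A,B$. Then for every $(u,v)$ such that the four unit squares containing $(u,v)$ are contained in $D$, $$F(u-\tfrac12,v+\tfrac12)F(u+\tfrac12,v-\tfrac12)-F(u+\tfrac12,v+\tfrac12)F(u-\tfrac12,v-\tfrac12)=A(u,v)B(u,v).$$
   Context: $[\cdot,\cdot,\cdot]$ is the determinant in $\mathbb{R}^3$. For a function $f$ on a subset of $\mathbb{Z}^2$: $f_1(u+\tfrac12,v)=f(u+1,v)-f(u,v)$, $f_2(u,v+\tfrac12)=f(u,v+1)-f(u,v)$, $f_{12}(u+\tfrac12,v+\tfrac12)=f(u+1,v+1)+f(u,v)-f(u+1,v)-f(u,v+1)$. The label $(u+\tfrac12,v+\tfrac12)$ denotes the unit square with lower-left vertex $(u,v)$. A discrete co-normal map is $\nu:D\to\mathbb{R}^3$ with $\nu_{12}=0$ and $F(u+\tfrac12,v+\tfrac12):=\nu(u,v)\cdot(\nu(u,v+1)\times\nu(u+1,v))>0$ on every unit square of $D$. A map $q:D\to\mathbb{R}^3$ is a discrete affine minimal map if there is a discrete co-normal map $\nu$ with $q_1(u+\tfrac12,v)=\nu(u,v)\times\nu(u+1,v)$ and $q_2(u,v+\tfrac12)=-\nu(u,v)\times\nu(u,v+1)$ on all edges of $D$; the corresponding $F$ is its discrete affine metric. The affine normal is $\xi(u+\tfrac12,v+\tfrac12)=q_{12}(u+\tfrac12,v+\tfrac12)/F(u+\tfrac12,v+\tfrac12)$.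 The coefficients of the discrete cubic form are $$A(u,v)=[q_1(u-\tfrac12,v),q_1(u+\tfrac12,v),\xi(u\pm\tfrac12,v\pm\tfrac12)],\qquad B(u,v)=[q_2(u,v+\tfrac12),q_2(u,v-\tfrac12),\xi(u\pm\tfrac12,v\pm\tfrac12)],$$ where $\xi$ may be taken at any unit square of $D$ containing $(u,v)$ (the values do not depend on the choice). *)

theory Defs
  imports "HOL-Analysis.Analysis"
begin

unbundle cross3_syntax

text \<open>
  Half-integer labels are replaced by lower-left lattice points: the unit square
  labelled \<open>(u + 1/2, v + 1/2)\<close> is indexed by \<open>(u, v)\<close>, and so are the horizontal
  edge \<open>(u + 1/2, v)\<close> and the vertical edge \<open>(u, v + 1/2)\<close>. Thus \<open>diff1 f (u, v)\<close>
  is \<open>f_1(u + 1/2, v)\<close> and \<open>diff1 f (u - 1, v)\<close> is \<open>f_1(u - 1/2, v)\<close>.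
\<close>

definition diff1 :: "(int \<times> int \<Rightarrow> 'a::ab_group_add) \<Rightarrow> int \<times> int \<Rightarrow> 'a" where
  "diff1 f = (\<lambda>(u, v). f (u + 1, v) - f (u, v))"

definition diff2 :: "(int \<times> int \<Rightarrow> 'a::ab_group_add) \<Rightarrow> int \<times> int \<Rightarrow> 'a" where
  "diff2 f = (\<lambda>(u, v). f (u, v + 1) - f (u, v))"

definition diff12 :: "(int \<times> int \<Rightarrow> 'a::ab_group_add) \<Rightarrow> int \<times> int \<Rightarrow> 'a" where
  "diff12 f = (\<lambda>(u, v). f (u + 1, v + 1) + f (u, v) - f (u + 1, v) - f (u, v + 1))"

definition unit_square :: "int \<times> int \<Rightarrow> (int \<times> int) set" where
  "unit_square = (\<lambda>(u, v). {(u, v), (u + 1, v), (u, v + 1), (u + 1, v + 1)})"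

definition det3 :: "real^3 \<Rightarrow> real^3 \<Rightarrow> real^3 \<Rightarrow> real" where
  "det3 x y z = det (vector [x, y, z])"

definition conormal_metric :: "(int \<times> int \<Rightarrow> real^3) \<Rightarrow> int \<times> int \<Rightarrow> real" where
  "conormal_metric \<nu> = (\<lambda>(u, v). \<nu> (u, v) \<bullet> (\<nu> (u, v + 1) \<times> \<nu> (u + 1, v)))"

definition discrete_conormal_map :: "(int \<times> int) set \<Rightarrow> (int \<times> int \<Rightarrow> real^3) \<Rightarrow> bool" where
  "discrete_conormal_map D \<nu> \<longleftrightarrow>
     (\<forall>s. unit_square s \<subseteq> D \<longrightarrow> diff12 \<nu> s = 0 \<and> conormal_metric \<nu> s > 0)"

definition conormal_map_of ::
  "(int \<times> int) set \<Rightarrow> (int \<times> int \<Rightarrow> real^3) \<Rightarrow> (int \<times> int \<Rightarrow> real^3) \<Rightarrow> bool" where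
  "conormal_map_of D q \<nu> \<longleftrightarrow>
     discrete_conormal_map D \<nu> \<and>
     (\<forall>u v. (u, v) \<in> D \<and> (u + 1, v) \<in> D \<longrightarrow>
        diff1 q (u, v) = \<nu> (u, v) \<times> \<nu> (u + 1, v)) \<and>
     (\<forall>u v. (u, v) \<in> D \<and> (u, v + 1) \<in> D \<longrightarrow>
        diff2 q (u, v) = - (\<nu> (u, v) \<times> \<nu> (u, v + 1)))"

definition discrete_affine_minimal_map ::
  "(int \<times> int) set \<Rightarrow> (int \<times> int \<Rightarrow> real^3) \<Rightarrow> bool" where
  "discrete_affine_minimal_map D q \<longleftrightarrow> (\<exists>\<nu>. conormal_map_of D q \<nu>)"

definition discrete_affine_metric ::
  "(int \<times> int) set \<Rightarrow> (int \<times> int \<Rightarrow> real^3) \<Rightarrow> (int \<times> int \<Rightarrow> real) \<Rightarrow> bool" where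
  "discrete_affine_metric D q F \<longleftrightarrow>
     (\<exists>\<nu>. conormal_map_of D q \<nu> \<and>
       (\<forall>s. unit_square s \<subseteq> D \<longrightarrow> F s = conormal_metric \<nu> s))"

definition affine_normal ::
  "(int \<times> int \<Rightarrow> real^3) \<Rightarrow> (int \<times> int \<Rightarrow> real) \<Rightarrow> int \<times> int \<Rightarrow> real^3" where
  "affine_normal q F s = diff12 q s /\<^sub>R F s"

text \<open>
  The argument \<open>s\<close> below is the unit square containing \<open>(u, v)\<close> at which the affine
  normal is evaluated. The value does not depend on it, but rather than fixing one
  square by convention it is kept as a parameter.
\<close>

definition cubic_A ::
  "(int \<times> int \<Rightarrow> real^3) \<Rightarrow> (int \<times> int \<Rightarrow> real) \<Rightarrow> int \<times> int \<Rightarrow> int \<times> int \<Rightarrow> real" where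
  "cubic_A q F s = (\<lambda>(u, v). det3 (diff1 q (u - 1, v)) (diff1 q (u, v)) (affine_normal q F s))"

definition cubic_B ::
  "(int \<times> int \<Rightarrow> real^3) \<Rightarrow> (int \<times> int \<Rightarrow> real) \<Rightarrow> int \<times> int \<Rightarrow> int \<times> int \<Rightarrow> real" where
  "cubic_B q F s = (\<lambda>(u, v). det3 (diff2 q (u, v)) (diff2 q (u, v - 1)) (affine_normal q F s))"

end

theory Submission
  imports Defs
begin

text \<open>
  The affine normal at a square pairs to 1 with the co-normals at all four vertices.
  Since the two edge vectors occurring in \<open>A\<close> are both orthogonal to
  \<open>n = \<nu>(u, v)\<close>, their cross product is a multiple of \<open>n\<close>, and pairing it with the affine
  normal leaves a determinant of three co-normals; the same holds for \<open>B\<close>. With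
  \<open>a, b, c, d\<close> the co-normals at the right, upper, left and lower neighbours, the claim
  becomes the Grassmann--Pluecker relation between the six determinants \<open>[n, x, y]\<close>,
  \<open>x, y \<in> {a, b, c, d}\<close>.
\<close>

lemma det3_eq_inner_cross: "det3 x y z = (x \<times> y) \<bullet> z"
  unfolding det3_def dot_cross_det[symmetric]
  by (simp add: cross3_simps)

text \<open>Here (c \<times> n) \<times> (n \<times> a) = [c, n, a] n and (n \<times> b) \<times> (d
  \<times> n) = - [n, b, d] n. The factors are ordered as the edges are in \<open>cubic_A\<close>
  and \<open>cubic_B\<close>.\<close>

lemma det3_cross_cross_common:
  "det3 (c \<times> n) (n \<times> a) y = det3 c n a * (n \<bullet> y)"
  "det3 (n \<times> b) (d \<times> n) y = - det3 n b d * (n \<bullet> y)"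
  unfolding det3_eq_inner_cross by (simp_all add: cross3_simps)

text \<open>For fixed n, [n, x, y] is an alternating form on the quotient by n. For n nonzero that
  is a plane, so this is the three-term relation among four plane vectors.\<close>

lemma grassmann_pluecker3:
  "det3 n a b * det3 n c d - det3 n a c * det3 n b d + det3 n a d * det3 n b c = 0"
  unfolding det3_eq_inner_cross by (simp add: cross3_simps)

lemma conormal_step:
  assumes "discrete_conormal_map D \<nu>" and "unit_square (i, j) \<subseteq> D"
  shows "\<nu> (i + 1, j + 1) = \<nu> (i + 1, j) + \<nu> (i, j + 1) - \<nu> (i, j)"
proof -
  have "diff12 \<nu> (i, j) = 0"
    using assms unfolding discrete_conormal_map_def by blast
  then have "\<nu> (i + 1, j + 1) + \<nu> (i, j) - \<nu> (i + 1, j) - \<nu> (i, j + 1) = 0"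
    by (simp add: diff12_def)
  then show ?thesis by (simp add: algebra_simps)
qed

text \<open>With n, a, b the values of \<nu> at the lower-left, lower-right and upper-left vertices,
  \<open>diff12 q r\<close> is (b - n) \<times> (a - n). Its inner product is therefore constant on
  n + span {a - n, b - n}, which contains the fourth co-normal a + b - n; at n it equals n \<bullet>
  (b \<times> a), the metric.\<close>

lemma conormal_inner_diff12:
  assumes q: "conormal_map_of D q \<nu>" and r: "unit_square r \<subseteq> D" and w: "w \<in> unit_square r"
  shows "\<nu> w \<bullet> diff12 q r = conormal_metric \<nu> r"
proof -
  obtain i j where ij: "r = (i, j)" by (cases r)
  have \<nu>: "discrete_conormal_map D \<nu>"
    using q by (simp add: conormal_map_of_def)
  have D: "(i, j) \<in> D" "(i + 1, j) \<in> D" "(i, j + 1) \<in> D" "(i + 1, j + 1) \<in> D"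
    using r by (auto simp: ij unit_square_def)
  have step: "\<nu> (i + 1, j + 1) = \<nu> (i + 1, j) + \<nu> (i, j + 1) - \<nu> (i, j)"
    using conormal_step[OF \<nu>] r ij by simp
  have "diff12 q r = diff1 q (i, j + 1) - diff1 q (i, j)"
    by (simp add: ij diff12_def diff1_def algebra_simps)
  also have "\<dots> = \<nu> (i, j + 1) \<times> \<nu> (i + 1, j + 1) - \<nu> (i, j) \<times> \<nu> (i + 1, j)"
    using q D by (simp add: conormal_map_of_def)
  finally have q12: "diff12 q r =
    \<nu> (i, j + 1) \<times> (\<nu> (i + 1, j) + \<nu> (i, j + 1) - \<nu> (i, j)) - \<nu> (i, j) \<times> \<nu> (i + 1, j)"
    by (simp add: step)
  have "w = (i, j) \<or> w = (i + 1, j) \<or> w = (i, j + 1) \<or> w = (i + 1, j + 1)"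
    using w by (auto simp: ij unit_square_def)
  then show ?thesis
    unfolding q12
    by (elim disjE; simp add: conormal_metric_def ij step; simp add: cross3_simps)
qed

lemma conormal_inner_affine_normal:
  assumes q: "conormal_map_of D q \<nu>" and r: "unit_square r \<subseteq> D" and w: "w \<in> unit_square r"
    and F: "F r = conormal_metric \<nu> r"
  shows "\<nu> w \<bullet> affine_normal q F r = 1"
proof -
  have "conormal_metric \<nu> r > 0"
    using q r unfolding conormal_map_of_def discrete_conormal_map_def by blast
  then show ?thesis
    by (simp add: affine_normal_def F conormal_inner_diff12[OF q r w])
qed

theorem lemma9:
  fixes D :: "(int \<times> int) set"
    and q :: "int \<times> int \<Rightarrow> real^3"
    and F :: "int \<times> int \<Rightarrow> real"
    and u v :: int
    and s t :: "int \<times> int"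
  assumes "discrete_affine_minimal_map D q"
    and "discrete_affine_metric D q F"
    and "\<And>r. (u, v) \<in> unit_square r \<Longrightarrow> unit_square r \<subseteq> D"
    and "(u, v) \<in> unit_square s"
    and "(u, v) \<in> unit_square t"
  shows "F (u - 1, v) * F (u, v - 1) - F (u, v) * F (u - 1, v - 1)
       = cubic_A q F s (u, v) * cubic_B q F t (u, v)"
proof -
  \<comment> \<open>Taking \<nu> from the metric hypothesis ensures that the same \<nu> yields both
    the edges of q and F.\<close>
  obtain \<nu> where q: "conormal_map_of D q \<nu>"
    and F: "\<And>r. unit_square r \<subseteq> D \<Longrightarrow> F r = conormal_metric \<nu> r"
    using assms(2) unfolding discrete_affine_metric_def by blast
  have \<nu>: "discrete_conormal_map D \<nu>"
    using q by (simp add: conormal_map_of_def)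
  define n a b c d where "n = \<nu> (u, v)" and "a = \<nu> (u + 1, v)" and "b = \<nu> (u, v + 1)"
    and "c = \<nu> (u - 1, v)" and "d = \<nu> (u, v - 1)"
  note nabcd = n_def a_def b_def c_def d_def
  have sq: "unit_square (u, v) \<subseteq> D" "unit_square (u - 1, v) \<subseteq> D"
    "unit_square (u, v - 1) \<subseteq> D" "unit_square (u - 1, v - 1) \<subseteq> D"
    by (rule assms(3), simp add: unit_square_def)+
  then have D: "(u, v) \<in> D" "(u + 1, v) \<in> D" "(u, v + 1) \<in> D" "(u - 1, v) \<in> D" "(u, v - 1) \<in> D"
    by (auto simp: unit_square_def)
  \<comment> \<open>\<open>conormal_metric\<close> does not read the upper-right vertex of its
    square, so only these three diagonal neighbours of (u, v) enter.\<close>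
  have corners: "\<nu> (u - 1, v + 1) = b + c - n" "\<nu> (u + 1, v - 1) = a + d - n"
      "\<nu> (u - 1, v - 1) = c + d - n"
    using conormal_step[OF \<nu> sq(2)] conormal_step[OF \<nu> sq(3)] conormal_step[OF \<nu> sq(4)]
    by (simp_all add: nabcd algebra_simps)
  have metric: "F (u, v) = - det3 n a b" "F (u - 1, v) = - det3 n b c"
      "F (u, v - 1) = det3 n a d" "F (u - 1, v - 1) = - det3 n c d"
    by (simp_all add: F sq conormal_metric_def corners nabcd[symmetric] det3_eq_inner_cross)
      (simp_all add: cross3_simps)
  have edge1: "diff1 q (i, v) = \<nu> (i, v) \<times> \<nu> (i + 1, v)" if "(i, v) \<in> D" "(i + 1, v) \<in> D" for i
    using q that by (simp add: conormal_map_of_def)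
  have edge2: "diff2 q (u, j) = - (\<nu> (u, j) \<times> \<nu> (u, j + 1))" if "(u, j) \<in> D" "(u, j + 1) \<in> D" for j
    using q that by (simp add: conormal_map_of_def)
  have edges: "diff1 q (u, v) = n \<times> a" "diff1 q (u - 1, v) = c \<times> n"
      "diff2 q (u, v) = - (n \<times> b)" "diff2 q (u, v - 1) = - (d \<times> n)"
    using edge1[of u] edge1[of "u - 1"] edge2[of v] edge2[of "v - 1"] D by (simp_all add: nabcd)
  have normal: "n \<bullet> affine_normal q F r = 1" if "(u, v) \<in> unit_square r" for r
    unfolding n_def
    using conormal_inner_affine_normal[where F = F, OF q assms(3)[OF that] that F[OF assms(3)[OF that]]] .
  have "cubic_A q F s (u, v) = det3 (c \<times> n) (n \<times> a) (affine_normal q F s)"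
    by (simp add: cubic_A_def edges)
  also have "\<dots> = det3 n a c"
    by (simp add: det3_cross_cross_common normal[OF assms(4)]) (simp add: det3_eq_inner_cross cross3_simps)
  finally have A: "cubic_A q F s (u, v) = det3 n a c" .
  \<comment> \<open>The minus signs of the two vertical edges cancel.\<close>
  have "cubic_B q F t (u, v) = det3 (n \<times> b) (d \<times> n) (affine_normal q F t)"
    by (simp add: cubic_B_def edges det3_eq_inner_cross cross_minus_left cross_minus_right)
  also have "\<dots> = - det3 n b d"
    by (simp add: det3_cross_cross_common normal[OF assms(5)])
  finally have B: "cubic_B q F t (u, v) = - det3 n b d" .
  \<comment> \<open>Both sides equal - [n, a, c] [n, b, d]: the products of metrics give the other
    two terms of the relation.\<close>
  show ?thesis
    using grassmann_pluecker3[of n a b c d] unfolding metric A B by (simp add: algebra_simps)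
qed

end
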